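(* Let $G$ be a finite group and let $\mathfrak{S}(G)$ denote the set of 2-generator subgroups of $G$, i.e. the subgroups of the form $\langle x,y\rangle$ with $x,y\in G$. Then $$\exp\Gamma_{\mathrm u}(G)\quad\text{divides}\quad \underset{S\in\mathfrak{S}(G)}{\mathrm{lcm}}\ \exp\Gamma_{\mathrm u}(S).$$
   Context: All groups are finite; $\exp$ is the exponent, $o(g)$ the order of $g$. $Z^2(G)$ is the group, under pointwise multiplication, of normalized 2-cocycles $\alpha:G\times G\to\mathbb{C}^\times$, i.e. $\alpha(x,y)\alpha(xy,z)=\alpha(x,yz)\alpha(y,z)$ and $\alpha(1,1)=1$. For a finite abelian group $A$, $\check A=\mathrm{Hom}(A,\mathbb{C}^\times)$. For a finite subgroup $H\le Z^2(G)$, the central extension $\check H\propto G$ of $G$ by $\check H$ is defined on the set $G\times\check H$ with multiplication $(g,\chi)(h,\psi)=(gh,\omega(g,h)\chi\psi)$, where $\omega(g,h)\in\check H$ is $\omega(g,h)(\alpha)=\alpha(g,h)$ for $\alpha\in H$. A cocycle $\alpha\in Z^2(G)$ is unitary if $\prod_{j=0}^{o(g)-1}\alpha(g,g^j)=1$ for every $g\in G$. The unitary cocycles form a finite subgroup $Z_{\mathrm u}(G)\le Z^2(G)$, and the unitary cover of $G$ is $\Gamma_{\mathrm u}(G)=\check{Z_{\mathrm u}(G)}\propto G$. *)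

theory Defs
  imports Complex_Main "HOL-Algebra.Multiplicative_Group" "HOL-Algebra.Product_Groups"
begin

definition complex_units :: "complex monoid" where
  "complex_units = \<lparr>carrier = UNIV - {0}, monoid.mult = (*), one = 1\<rparr>"

text \<open>
  The defining property has a witness whenever the group is finite; otherwise the
  value may be unspecified.
\<close>
definition group_exponent :: "('a, 'b) monoid_scheme \<Rightarrow> nat" where
  "group_exponent G = (LEAST n. 0 < n \<and> (\<forall>x\<in>carrier G. x [^]\<^bsub>G\<^esub> n = \<one>\<^bsub>G\<^esub>))"

text \<open>
  Functions on a carrier are represented as extensional functions (value
  \<^const>\<open>undefined\<close> off the domain), so that equality in the groups below is
  equality on the domain. The pointwise operations are those of
  \<^const>\<open>product_group\<close>.
\<close>
definition cocycle_group :: "('a, 'b) monoid_scheme \<Rightarrow> ('a \<times> 'a \<Rightarrow> complex) monoid" where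
  "cocycle_group G =
    (product_group (carrier G \<times> carrier G) (\<lambda>_. complex_units))
    \<lparr>carrier := {\<alpha> \<in> carrier G \<times> carrier G \<rightarrow>\<^sub>E carrier complex_units.
       (\<forall>x\<in>carrier G. \<forall>y\<in>carrier G. \<forall>z\<in>carrier G.
          \<alpha> (x, y) * \<alpha> (x \<otimes>\<^bsub>G\<^esub> y, z) = \<alpha> (x, y \<otimes>\<^bsub>G\<^esub> z) * \<alpha> (y, z)) \<and>
       \<alpha> (\<one>\<^bsub>G\<^esub>, \<one>\<^bsub>G\<^esub>) = 1}\<rparr>"

definition character_group :: "('a, 'b) monoid_scheme \<Rightarrow> ('a \<Rightarrow> complex) monoid" where
  "character_group A =
    (product_group (carrier A) (\<lambda>_. complex_units))
    \<lparr>carrier := hom A complex_units \<inter> extensional (carrier A)\<rparr>"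

definition cocycle_eval ::
    "('a \<times> 'a \<Rightarrow> complex) set \<Rightarrow> 'a \<Rightarrow> 'a \<Rightarrow> ('a \<times> 'a \<Rightarrow> complex) \<Rightarrow> complex" where
  "cocycle_eval H g h = (\<lambda>\<alpha>\<in>H. \<alpha> (g, h))"

text \<open>
  Intended for a finite subgroup \<open>H\<close> of \<^term>\<open>cocycle_group G\<close>. The displayed unit is
  the identity because the cocycle identity and \<open>\<alpha>(1,1) = 1\<close> give
  \<open>\<alpha>(1,g) = \<alpha>(g,1) = 1\<close>.
\<close>
definition central_extension ::
    "('a \<times> 'a \<Rightarrow> complex) set \<Rightarrow> ('a, 'b) monoid_scheme
      \<Rightarrow> ('a \<times> (('a \<times> 'a \<Rightarrow> complex) \<Rightarrow> complex)) monoid" where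
  "central_extension H G =
    (let D = character_group (cocycle_group G\<lparr>carrier := H\<rparr>) in
      \<lparr>carrier = carrier G \<times> carrier D,
       monoid.mult = (\<lambda>(g, \<chi>) (h, \<psi>).
         (g \<otimes>\<^bsub>G\<^esub> h, cocycle_eval H g h \<otimes>\<^bsub>D\<^esub> \<chi> \<otimes>\<^bsub>D\<^esub> \<psi>)),
       one = (\<one>\<^bsub>G\<^esub>, \<one>\<^bsub>D\<^esub>)\<rparr>)"

definition unitary_cocycles :: "('a, 'b) monoid_scheme \<Rightarrow> ('a \<times> 'a \<Rightarrow> complex) set" where
  "unitary_cocycles G =
    {\<alpha> \<in> carrier (cocycle_group G).
       \<forall>g\<in>carrier G. (\<Prod>j<group.ord G g. \<alpha> (g, g [^]\<^bsub>G\<^esub> j)) = 1}"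

definition unitary_cover ::
    "('a, 'b) monoid_scheme \<Rightarrow> ('a \<times> (('a \<times> 'a \<Rightarrow> complex) \<Rightarrow> complex)) monoid" where
  "unitary_cover G = central_extension (unitary_cocycles G) G"

definition two_generator_subgroups :: "('a, 'b) monoid_scheme \<Rightarrow> 'a set set" where
  "two_generator_subgroups G =
    {generate G {x, y} | x y. x \<in> carrier G \<and> y \<in> carrier G}"

end

theory Submission
  imports Defs
begin

text \<open>
  All \<open>n\<close>-th powers in the unitary cover of \<open>G\<close> are trivial iff those of all elements of \<open>G\<close> and of
  all values of unitary cocycles are: unitarity makes \<open>(g, \<chi>)\<^sup>n = (1, \<chi>\<^sup>n)\<close> whenever \<open>g\<^sup>n = 1\<close>, and
  the characters \<open>\<omega>(x, y)\<close> detect the values \<open>\<alpha>(x, y)\<close>. Each \<open>g\<close> lies in a 2-generator subgroup, and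
  each \<open>\<alpha>(x, y)\<close> is a value of the restriction of \<open>\<alpha>\<close> to \<open>\<langle>x, y\<rangle>\<close>, which is again unitary.
\<close>

section \<open>Unfolding of the groups, and powers in central extensions\<close>

lemma complex_units_simps [simp]:
  "carrier complex_units = UNIV - {0}"
  "x \<otimes>\<^bsub>complex_units\<^esub> y = x * y"
  "\<one>\<^bsub>complex_units\<^esub> = 1"
  by (simp_all add: complex_units_def)

lemma mem_cocycle_group_iff:
  "\<alpha> \<in> carrier (cocycle_group G) \<longleftrightarrow>
    \<alpha> \<in> carrier G \<times> carrier G \<rightarrow>\<^sub>E UNIV - {0} \<and>
    (\<forall>x\<in>carrier G. \<forall>y\<in>carrier G. \<forall>z\<in>carrier G.
      \<alpha> (x, y) * \<alpha> (x \<otimes>\<^bsub>G\<^esub> y, z) = \<alpha> (x, y \<otimes>\<^bsub>G\<^esub> z) * \<alpha> (y, z)) \<and>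
    \<alpha> (\<one>\<^bsub>G\<^esub>, \<one>\<^bsub>G\<^esub>) = 1"
  by (simp add: cocycle_group_def)

lemma mult_cocycle_group:
  "\<alpha> \<otimes>\<^bsub>cocycle_group G\<^esub> \<beta> = (\<lambda>p\<in>carrier G \<times> carrier G. \<alpha> p * \<beta> p)"
  by (simp add: cocycle_group_def product_group_def)

lemma character_group_simps:
  "carrier (character_group A) = hom A complex_units \<inter> extensional (carrier A)"
  "\<chi> \<otimes>\<^bsub>character_group A\<^esub> \<psi> = (\<lambda>a\<in>carrier A. \<chi> a * \<psi> a)"
  "\<one>\<^bsub>character_group A\<^esub> = (\<lambda>a\<in>carrier A. 1)"
  by (simp_all add: character_group_def product_group_def)

text \<open>Powers are built by right multiplication with \<open>(g, \<chi>)\<close>, so step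
  \<open>j\<close> contributes the cocycle factor \<open>\<alpha> (g^j, g)\<close>.\<close>

lemma central_extension_pow:
  "(g, \<chi>) [^]\<^bsub>central_extension H G\<^esub> (n::nat) =
    (g [^]\<^bsub>G\<^esub> n, \<lambda>\<alpha>\<in>H. (\<Prod>j<n. \<alpha> (g [^]\<^bsub>G\<^esub> j, g)) * \<chi> \<alpha> ^ n)"
proof (induction n)
  case 0
  then show ?case
    by (auto simp: nat_pow_def central_extension_def Let_def character_group_simps)
next
  case (Suc n)
  have "(g, \<chi>) [^]\<^bsub>central_extension H G\<^esub> Suc n =
      (g, \<chi>) [^]\<^bsub>central_extension H G\<^esub> n \<otimes>\<^bsub>central_extension H G\<^esub> (g, \<chi>)"
    by (simp add: nat_pow_def)
  also have "\<dots> = (g [^]\<^bsub>G\<^esub> n \<otimes>\<^bsub>G\<^esub> g,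
      \<lambda>\<alpha>\<in>H. (\<Prod>j<Suc n. \<alpha> (g [^]\<^bsub>G\<^esub> j, g)) * \<chi> \<alpha> ^ Suc n)"
    unfolding Suc.IH
    by (auto simp: central_extension_def Let_def character_group_simps cocycle_eval_def
        restrict_def fun_eq_iff mult_ac)
  finally show ?case
    by (auto simp: nat_pow_def)
qed

section \<open>Divisibility by a least exponent\<close>

text \<open>Division with remainder: \<open>N mod e\<close> satisfies \<open>P\<close> and lies
  below the minimum \<open>e\<close>, so it is 0. For \<open>N = 0\<close> the claim holds whether
  or not a positive witness exists.\<close>

lemma Least_pos_dvd:
  fixes P :: "nat \<Rightarrow> bool"
  assumes "P N" and mod: "\<And>m n. P m \<Longrightarrow> P n \<Longrightarrow> P (m mod n)"
  shows "(LEAST n. 0 < n \<and> P n) dvd N"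
proof (cases "N = 0")
  case False
  define e where "e = (LEAST n. 0 < n \<and> P n)"
  have e: "0 < e \<and> P e"
    unfolding e_def by (rule LeastI[of _ N]) (use assms False in auto)
  have "\<not> 0 < N mod e"
    using not_less_Least[of "N mod e" "\<lambda>n. 0 < n \<and> P n"] e mod[OF \<open>P N\<close>, of e]
    by (auto simp: e_def)
  then show ?thesis
    by (auto simp: e_def)
qed simp

lemma power_mod_eq_1:
  fixes a :: "'a :: monoid_mult"
  assumes "a ^ m = 1" and "a ^ n = 1"
  shows "a ^ (m mod n) = 1"
proof -
  have "a ^ m = (a ^ n) ^ (m div n) * a ^ (m mod n)"
    by (metis mult_div_mod_eq power_add power_mult)
  with assms show ?thesis by simp
qed

section \<open>Elementary identities for normalized cocycles\<close>

context group
begin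

context
  fixes \<alpha> :: "'a \<times> 'a \<Rightarrow> complex"
  assumes cocycle: "\<alpha> \<in> carrier (cocycle_group G)"
begin

lemma cocycle_nonzero: "x \<in> carrier G \<Longrightarrow> y \<in> carrier G \<Longrightarrow> \<alpha> (x, y) \<noteq> 0"
  using cocycle by (auto simp: mem_cocycle_group_iff PiE_def Pi_def)

lemma cocycle_identity:
  "x \<in> carrier G \<Longrightarrow> y \<in> carrier G \<Longrightarrow> z \<in> carrier G \<Longrightarrow>
    \<alpha> (x, y) * \<alpha> (x \<otimes> y, z) = \<alpha> (x, y \<otimes> z) * \<alpha> (y, z)"
  using cocycle by (simp add: mem_cocycle_group_iff)

lemma cocycle_one_one: "\<alpha> (\<one>, \<one>) = 1"
  using cocycle by (simp add: mem_cocycle_group_iff)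

lemma cocycle_one_left: "x \<in> carrier G \<Longrightarrow> \<alpha> (\<one>, x) = 1"
  using cocycle_identity[of \<one> \<one> x] cocycle_nonzero[of \<one> x] by (simp add: cocycle_one_one)

lemma cocycle_one_right: "x \<in> carrier G \<Longrightarrow> \<alpha> (x, \<one>) = 1"
  using cocycle_identity[of x \<one> \<one>] cocycle_nonzero[of x \<one>] by (simp add: cocycle_one_one)

text \<open>Reconciles the factors \<open>\<alpha> (g^j, g)\<close> from powers in the extension
  with the factors \<open>\<alpha> (g, g^j)\<close> in the definition of unitarity. Induction uses
  the cocycle identity at \<open>(g, g^j, g)\<close>.\<close>

lemma cocycle_pow_commute:
  assumes g: "g \<in> carrier G"
  shows "\<alpha> (g [^] (j::nat), g) = \<alpha> (g, g [^] j)"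
proof (induction j)
  case 0
  show ?case using g by (simp add: cocycle_one_left cocycle_one_right)
next
  case (Suc j)
  have "\<alpha> (g, g [^] j) * \<alpha> (g [^] Suc j, g) = \<alpha> (g, g [^] Suc j) * \<alpha> (g [^] j, g)"
    using cocycle_identity[OF g nat_pow_closed[OF g] g, of j]
    by (simp only: nat_pow_Suc2[OF g, of j, symmetric] nat_pow_Suc[of g j, symmetric])
  with Suc show ?case
    using cocycle_nonzero[of g "g [^] j"] g by simp
qed

end

section \<open>Products of values of unitary cocycles\<close>

lemma bij_betw_mult_left:
  assumes "a \<in> carrier G"
  shows "bij_betw ((\<otimes>) a) (carrier G) (carrier G)"
  by (rule bij_betw_byWitness[where f' = "(\<otimes>) (inv a)"])
    (use assms in \<open>auto simp: m_assoc[symmetric]\<close>)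

lemma unitary_cocyclesD:
  assumes "\<alpha> \<in> unitary_cocycles G"
  shows "\<alpha> \<in> carrier (cocycle_group G)"
    and "g \<in> carrier G \<Longrightarrow> (\<Prod>j<ord g. \<alpha> (g, g [^] j)) = 1"
  using assms by (auto simp: unitary_cocycles_def)

text \<open>
  The cocycle identity telescopes the product of the \<open>\<alpha>(g, g\<^sup>jz)\<close>, \<open>j < o(g)\<close>, to that of the
  \<open>\<alpha>(g, g\<^sup>j)\<close>.
\<close>
lemma unitary_prod_row_pow:
  assumes u: "\<alpha> \<in> unitary_cocycles G" and g: "g \<in> carrier G"
  shows "(\<Prod>z\<in>carrier G. \<alpha> (g, z)) ^ ord g = 1"
proof -
  note c = unitary_cocyclesD(1)[OF u]
  have tele: "(\<Prod>j<ord g. \<alpha> (g, g [^] j \<otimes> z)) = 1" if z: "z \<in> carrier G" for z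
  proof -
    have "(\<Prod>j<n. \<alpha> (g, g [^] j \<otimes> z)) = (\<Prod>j<n. \<alpha> (g, g [^] j)) * \<alpha> (g [^] n, z)" for n :: nat
    proof (induction n)
      case 0
      show ?case using z by (simp add: cocycle_one_left[OF c])
    next
      case (Suc n)
      have "\<alpha> (g, g [^] n) * \<alpha> (g [^] Suc n, z) = \<alpha> (g, g [^] n \<otimes> z) * \<alpha> (g [^] n, z)"
        using cocycle_identity[OF c g nat_pow_closed[OF g] z, of n]
        by (simp only: nat_pow_Suc2[OF g, symmetric])
      with Suc show ?case by (simp add: mult_ac)
    qed
    then show ?thesis
      using z g by (simp add: unitary_cocyclesD(2)[OF u] pow_ord_eq_1 cocycle_one_left[OF c])
  qed
  \<comment> \<open>Left translation by \<open>g^j\<close> permutes G, so the row product may be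
    written once for each \<open>j < ord g\<close>; swapping the double product then exposes the
    telescoped factors.\<close>
  have "(\<Prod>z\<in>carrier G. \<alpha> (g, z)) = (\<Prod>z\<in>carrier G. \<alpha> (g, g [^] j \<otimes> z))" for j :: nat
    using prod.reindex_bij_betw[OF bij_betw_mult_left[of "g [^] j"], of "\<lambda>z. \<alpha> (g, z)"] g
    by simp
  then have "(\<Prod>z\<in>carrier G. \<alpha> (g, z)) ^ ord g =
      (\<Prod>j<ord g. \<Prod>z\<in>carrier G. \<alpha> (g, g [^] j \<otimes> z))"
    by simp
  also have "\<dots> = (\<Prod>z\<in>carrier G. \<Prod>j<ord g. \<alpha> (g, g [^] j \<otimes> z))"
    by (rule prod.swap)
  finally show ?thesis by (simp add: tele)
qed

text \<open>Multiplying the cocycle identity over all \<open>z\<close> exhibits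
  \<open>\<alpha> (x, y) ^ order G\<close> as the coboundary of the row products \<open>f\<close>,
  whose own \<open>order G\<close>-th powers are 1. The bound is crude; it serves as a positive
  witness for the minimum in \<open>group_exponent\<close>.\<close>

lemma unitary_pow_order_squared:
  assumes u: "\<alpha> \<in> unitary_cocycles G"
    and x: "x \<in> carrier G" and y: "y \<in> carrier G"
  shows "\<alpha> (x, y) ^ (order G * order G) = 1"
proof -
  note c = unitary_cocyclesD(1)[OF u]
  define f where "f g = (\<Prod>z\<in>carrier G. \<alpha> (g, z))" for g
  have f1: "f g ^ order G = 1" if g: "g \<in> carrier G" for g
  proof -
    obtain k where "order G = ord g * k"
      using ord_dvd_group_order[OF g] by blast
    then show ?thesis
      using unitary_prod_row_pow[OF u g] by (simp add: f_def power_mult)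
  qed
  have "(\<Prod>z\<in>carrier G. \<alpha> (x, y) * \<alpha> (x \<otimes> y, z)) = (\<Prod>z\<in>carrier G. \<alpha> (x, y \<otimes> z) * \<alpha> (y, z))"
    using cocycle_identity[OF c x y] by (rule prod.cong[OF refl])
  moreover have "(\<Prod>z\<in>carrier G. \<alpha> (x, y \<otimes> z)) = f x"
    using prod.reindex_bij_betw[OF bij_betw_mult_left[OF y], of "\<lambda>z. \<alpha> (x, z)"]
    by (simp add: f_def)
  ultimately have "\<alpha> (x, y) ^ order G * f (x \<otimes> y) = f x * f y"
    by (simp add: prod.distrib f_def order_def)
  then have "(\<alpha> (x, y) ^ order G * f (x \<otimes> y)) ^ order G = (f x * f y) ^ order G"
    by simp
  then show ?thesis
    using x y by (simp add: power_mult_distrib f1 power_mult)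
qed

text \<open>Since \<open>n\<close> is a multiple of \<open>ord g\<close>, the product splits into
  blocks of length \<open>ord g\<close>, and by periodicity of \<open>g^j\<close> each block is the
  product in the definition of unitarity.\<close>

lemma unitary_prod_eq_1:
  assumes u: "\<alpha> \<in> unitary_cocycles G" and g: "g \<in> carrier G" and n: "g [^] (n::nat) = \<one>"
  shows "(\<Prod>j<n. \<alpha> (g [^] j, g)) = 1"
proof -
  obtain k where k: "n = k * ord g"
    using n pow_eq_id[OF g] by (metis dvd_def mult.commute)
  have "(\<Prod>j\<in>{m * ord g..<m * ord g + ord g}. \<alpha> (g, g [^] j)) = 1" for m
  proof -
    have "(\<Prod>j\<in>{m * ord g..<m * ord g + ord g}. \<alpha> (g, g [^] j)) =
        (\<Prod>j<ord g. \<alpha> (g, g [^] (j + m * ord g)))"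
      using prod.shift_bounds_nat_ivl[of "\<lambda>j. \<alpha> (g, g [^] j)" 0 "m * ord g" "ord g"]
      by (simp add: add.commute lessThan_atLeast0)
    moreover have "g [^] (j + m * ord g) = g [^] j" for j :: nat
      using g pow_eq_id[of g "m * ord g"] by (simp flip: nat_pow_mult)
    ultimately show ?thesis by (simp add: unitary_cocyclesD(2)[OF u g])
  qed
  then show ?thesis
    using prod.nat_group[of "\<lambda>j. \<alpha> (g, g [^] j)" "ord g" k]
    by (simp add: k cocycle_pow_commute[OF unitary_cocyclesD(1)[OF u] g])
qed

section \<open>Characters of the group of unitary cocycles\<close>

lemma constant_one_unitary:
  "(\<lambda>p\<in>carrier G \<times> carrier G. 1) \<in> unitary_cocycles G"
  by (auto simp: unitary_cocycles_def mem_cocycle_group_iff)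

lemma unitary_mult_closed:
  assumes "\<alpha> \<in> unitary_cocycles G" and "\<beta> \<in> unitary_cocycles G"
  shows "\<alpha> \<otimes>\<^bsub>cocycle_group G\<^esub> \<beta> \<in> unitary_cocycles G"
proof -
  note c = unitary_cocyclesD(1)[OF assms(1)] unitary_cocyclesD(1)[OF assms(2)]
  have "\<alpha> (x, y) * \<beta> (x, y) * (\<alpha> (x \<otimes> y, z) * \<beta> (x \<otimes> y, z)) =
      \<alpha> (x, y \<otimes> z) * \<beta> (x, y \<otimes> z) * (\<alpha> (y, z) * \<beta> (y, z))"
    if "x \<in> carrier G" "y \<in> carrier G" "z \<in> carrier G" for x y z
    using arg_cong2[OF cocycle_identity[OF c(1) that] cocycle_identity[OF c(2) that], of "(*)"]
    by (simp only: mult_ac)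
  then have "\<alpha> \<otimes>\<^bsub>cocycle_group G\<^esub> \<beta> \<in> carrier (cocycle_group G)"
    by (auto simp: mult_cocycle_group mem_cocycle_group_iff cocycle_nonzero[OF c(1)]
        cocycle_nonzero[OF c(2)] cocycle_one_one[OF c(1)] cocycle_one_one[OF c(2)])
  then show ?thesis
    using unitary_cocyclesD(2)[OF assms(1)] unitary_cocyclesD(2)[OF assms(2)]
    by (simp add: unitary_cocycles_def mult_cocycle_group prod.distrib)
qed

text \<open>\<open>\<chi>\<close> turns pointwise powers of \<open>\<alpha>\<close> into powers of
  \<open>\<chi> \<alpha>\<close>, and the \<open>n\<close>-th pointwise power of
  \<open>\<alpha>\<close> is the trivial cocycle.\<close>

lemma character_pow_eq_1:
  assumes \<chi>: "\<chi> \<in> carrier (character_group (cocycle_group G\<lparr>carrier := unitary_cocycles G\<rparr>))"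
    and u: "\<alpha> \<in> unitary_cocycles G"
    and n: "\<And>x y. x \<in> carrier G \<Longrightarrow> y \<in> carrier G \<Longrightarrow> \<alpha> (x, y) ^ n = 1"
  shows "\<chi> \<alpha> ^ n = 1"
proof -
  define pw where "pw k = (\<lambda>p\<in>carrier G \<times> carrier G. \<alpha> p ^ k)" for k :: nat
  have nz: "\<chi> \<beta> \<noteq> 0" if "\<beta> \<in> unitary_cocycles G" for \<beta>
    using \<chi> that by (auto simp: character_group_simps hom_def Pi_def)
  have mult: "\<chi> (\<beta> \<otimes>\<^bsub>cocycle_group G\<^esub> \<gamma>) = \<chi> \<beta> * \<chi> \<gamma>"
    if "\<beta> \<in> unitary_cocycles G" "\<gamma> \<in> unitary_cocycles G" for \<beta> \<gamma>
    using \<chi> that by (auto simp: character_group_simps hom_def)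
  have pw0: "pw 0 \<in> unitary_cocycles G"
    using constant_one_unitary by (simp add: pw_def)
  \<comment> \<open>\<open>hom\<close> provides only multiplicativity; the trivial cocycle goes to 1
    because its image is a nonzero idempotent.\<close>
  have "pw 0 \<otimes>\<^bsub>cocycle_group G\<^esub> pw 0 = pw 0"
    by (simp add: pw_def mult_cocycle_group restrict_def fun_eq_iff)
  with mult[OF pw0 pw0] nz[OF pw0] have \<chi>0: "\<chi> (pw 0) = 1"
    by simp
  have "pw k \<in> unitary_cocycles G \<and> \<chi> (pw k) = \<chi> \<alpha> ^ k" for k
  proof (induction k)
    case 0
    show ?case using pw0 \<chi>0 by simp
  next
    case (Suc k)
    have "pw (Suc k) = \<alpha> \<otimes>\<^bsub>cocycle_group G\<^esub> pw k"
      by (simp add: pw_def mult_cocycle_group restrict_def fun_eq_iff)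
    with Suc u show ?case
      by (simp add: unitary_mult_closed mult)
  qed
  moreover have "pw n = pw 0"
    using n by (auto simp: pw_def restrict_def fun_eq_iff)
  ultimately show ?thesis
    using \<chi>0 by metis
qed

lemma cocycle_eval_character:
  assumes "x \<in> carrier G" and "y \<in> carrier G"
  shows "cocycle_eval (unitary_cocycles G) x y
    \<in> carrier (character_group (cocycle_group G\<lparr>carrier := unitary_cocycles G\<rparr>))"
  using assms unitary_mult_closed
  by (auto simp: character_group_simps cocycle_eval_def hom_def mult_cocycle_group
      cocycle_nonzero unitary_cocyclesD(1))

section \<open>The exponent of the unitary cover\<close>

text \<open>Rewrites the predicate minimized in \<open>group_exponent\<close> into conditions on
  single elements and single cocycle values, which can be compared between G and its
  subgroups.\<close>

lemma unitary_cover_pow_eq_one_iff: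
  "(\<forall>p\<in>carrier (unitary_cover G). p [^]\<^bsub>unitary_cover G\<^esub> n = \<one>\<^bsub>unitary_cover G\<^esub>) \<longleftrightarrow>
    (\<forall>g\<in>carrier G. g [^] n = \<one>) \<and>
    (\<forall>\<alpha>\<in>unitary_cocycles G. \<forall>x\<in>carrier G. \<forall>y\<in>carrier G. \<alpha> (x, y) ^ n = 1)"
  (is "?L \<longleftrightarrow> ?R")
proof -
  let ?H = "unitary_cocycles G"
  let ?D = "character_group (cocycle_group G\<lparr>carrier := ?H\<rparr>)"
  have "\<one>\<^bsub>unitary_cover G\<^esub> = (\<one>, \<lambda>\<alpha>\<in>?H. 1)"
    and car: "carrier (unitary_cover G) = carrier G \<times> carrier ?D"
    by (simp_all add: unitary_cover_def central_extension_def Let_def character_group_simps)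
  then have pow: "(g, \<chi>) [^]\<^bsub>unitary_cover G\<^esub> n = \<one>\<^bsub>unitary_cover G\<^esub> \<longleftrightarrow>
      g [^] n = \<one> \<and> (\<forall>\<alpha>\<in>?H. (\<Prod>j<n. \<alpha> (g [^] j, g)) * \<chi> \<alpha> ^ n = 1)" for g \<chi>
    by (auto simp: unitary_cover_def central_extension_pow restrict_def fun_eq_iff)
  show ?thesis
  proof
    assume L: ?L
    have ev: "g [^] n = \<one> \<and> (\<forall>\<alpha>\<in>?H. (\<Prod>j<n. \<alpha> (g [^] j, g)) * \<alpha> (x, y) ^ n = 1)"
      if "g \<in> carrier G" "x \<in> carrier G" "y \<in> carrier G" for g x y
    proof -
      have "(g, cocycle_eval ?H x y) \<in> carrier (unitary_cover G)"
        using that cocycle_eval_character by (simp add: car)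
      with L show ?thesis
        unfolding pow[symmetric, of g] by (fastforce simp: pow cocycle_eval_def)
    qed
    \<comment> \<open>Arbitrary \<open>g\<close> gives the condition on elements. At
      \<open>g = \<one>\<close> every cocycle factor is
      \<open>\<alpha> (\<one>, \<one>) = 1\<close>, which isolates
      \<open>\<alpha> (x, y) ^ n\<close>.\<close>
    show ?R
      using ev ev[of \<one>] by (auto simp: cocycle_one_one unitary_cocyclesD(1))
  next
    assume ?R
    then show ?L
      by (auto simp: car pow unitary_prod_eq_1 character_pow_eq_1)
  qed
qed

lemma unitary_cover_exponent_dvd:
  assumes "\<And>g. g \<in> carrier G \<Longrightarrow> g [^] N = \<one>"
    and "\<And>\<alpha> x y. \<alpha> \<in> unitary_cocycles G \<Longrightarrow> x \<in> carrier G \<Longrightarrow> y \<in> carrier G \<Longrightarrow> \<alpha> (x, y) ^ N = 1"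
  shows "group_exponent (unitary_cover G) dvd N"
  unfolding group_exponent_def unitary_cover_pow_eq_one_iff
  by (rule Least_pos_dvd) (use assms in \<open>auto simp: pow_eq_id dvd_mod power_mod_eq_1\<close>)

lemma
  assumes "finite (carrier G)"
  shows pow_unitary_cover_exponent:
      "g \<in> carrier G \<Longrightarrow> g [^] group_exponent (unitary_cover G) = \<one>"
    and unitary_cocycle_pow_unitary_cover_exponent:
      "\<alpha> \<in> unitary_cocycles G \<Longrightarrow> x \<in> carrier G \<Longrightarrow> y \<in> carrier G
        \<Longrightarrow> \<alpha> (x, y) ^ group_exponent (unitary_cover G) = 1"
proof -
  let ?P = "\<lambda>n. 0 < n \<and> (\<forall>g\<in>carrier G. g [^] n = \<one>) \<and>
    (\<forall>\<alpha>\<in>unitary_cocycles G. \<forall>x\<in>carrier G. \<forall>y\<in>carrier G. \<alpha> (x, y) ^ n = 1)"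
  \<comment> \<open>Finiteness makes \<open>order G\<close> positive, so this witness ensures that
    the least exponent satisfies its defining property.\<close>
  have "?P (order G * order G)"
    using assms
    by (auto simp: order_gt_0_iff_finite unitary_pow_order_squared pow_order_eq_1
        simp flip: nat_pow_pow)
  then have "?P (group_exponent (unitary_cover G))"
    unfolding group_exponent_def unitary_cover_pow_eq_one_iff by (rule LeastI)
  then show "g \<in> carrier G \<Longrightarrow> g [^] group_exponent (unitary_cover G) = \<one>"
    and "\<alpha> \<in> unitary_cocycles G \<Longrightarrow> x \<in> carrier G \<Longrightarrow> y \<in> carrier G
        \<Longrightarrow> \<alpha> (x, y) ^ group_exponent (unitary_cover G) = 1"
    by auto
qed

section \<open>Passage to 2-generator subgroups\<close>

lemma unitary_cocycles_restrict:
  assumes "subgroup S G" and u: "\<alpha> \<in> unitary_cocycles G"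
  shows "restrict \<alpha> (S \<times> S) \<in> unitary_cocycles (G\<lparr>carrier := S\<rparr>)"
proof -
  interpret S: subgroup S G by fact
  interpret GS: group "G\<lparr>carrier := S\<rparr>" by (rule S.subgroup_is_group[OF is_group])
  \<comment> \<open>The order fixes the number of factors in the unitarity product, so it must agree
    in the subgroup and in G.\<close>
  have ord: "GS.ord g = ord g" for g
    by (simp add: GS.ord_def ord_def nat_pow_consistent[symmetric])
  have pow: "g [^] (j::nat) \<in> S" if "g \<in> S" for g j
    using GS.nat_pow_closed[of g j] that by (simp add: nat_pow_consistent[symmetric])
  have "restrict \<alpha> (S \<times> S) \<in> carrier (cocycle_group (G\<lparr>carrier := S\<rparr>))"
    using unitary_cocyclesD(1)[OF u]
    by (auto simp: mem_cocycle_group_iff PiE_def Pi_def)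
  moreover have "(\<Prod>j<ord g. restrict \<alpha> (S \<times> S) (g, g [^] j)) = 1" if "g \<in> S" for g
    using that pow unitary_cocyclesD(2)[OF u, of g] by simp
  ultimately show ?thesis
    by (simp add: unitary_cocycles_def ord nat_pow_consistent[symmetric])
qed

end

theorem proposition6:
  fixes G :: "('a, 'b) monoid_scheme"
  assumes "group G" and "finite (carrier G)"
  shows "group_exponent (unitary_cover G)
           dvd (LCM S\<in>two_generator_subgroups G.
                  group_exponent (unitary_cover (G\<lparr>carrier := S\<rparr>)))"
proof -
  interpret group G by fact
  define N where "N = (LCM S\<in>two_generator_subgroups G.
    group_exponent (unitary_cover (G\<lparr>carrier := S\<rparr>)))"
  \<comment> \<open>Each condition to be checked involves at most two elements, so it can be tested
    inside the subgroup they generate.\<close>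
  have key: "x [^]\<^bsub>G\<^esub> N = \<one>\<^bsub>G\<^esub> \<and> (\<forall>\<alpha>\<in>unitary_cocycles G. \<alpha> (x, y) ^ N = 1)"
    if "x \<in> carrier G" "y \<in> carrier G" for x y
  proof -
    define S where "S = generate G {x, y}"
    define e where "e = group_exponent (unitary_cover (G\<lparr>carrier := S\<rparr>))"
    have sub: "subgroup S G"
      unfolding S_def using that by (intro generate_is_subgroup) auto
    have xy: "x \<in> S" "y \<in> S"
      by (auto simp: S_def intro: generate.incl)
    interpret GS: group "G\<lparr>carrier := S\<rparr>"
      by (rule subgroup.subgroup_is_group[OF sub is_group])
    have fin: "finite (carrier (G\<lparr>carrier := S\<rparr>))"
      using subgroup.subset[OF sub] assms(2) by (auto intro: finite_subset)
    have "S \<in> two_generator_subgroups G"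
      using that by (auto simp: two_generator_subgroups_def S_def)
    then have "e dvd N"
      unfolding N_def e_def by (intro dvd_Lcm imageI)
    then obtain k where k: "N = e * k" by blast
    have "x [^]\<^bsub>G\<^esub> e = \<one>\<^bsub>G\<^esub>"
      using GS.pow_unitary_cover_exponent[OF fin, of x] xy
      by (simp add: e_def nat_pow_consistent[symmetric])
    then have "x [^]\<^bsub>G\<^esub> N = \<one>\<^bsub>G\<^esub>"
      using that by (simp add: k flip: nat_pow_pow)
    \<comment> \<open>The restriction of \<open>\<alpha>\<close> to \<open>S \<times> S\<close>
      agrees with \<open>\<alpha>\<close> at \<open>(x, y)\<close>, so the exponent \<open>e\<close>
      of the cover of \<open>S\<close> already kills this value.\<close>
    moreover have "\<alpha> (x, y) ^ N = 1" if "\<alpha> \<in> unitary_cocycles G" for \<alpha>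
      using GS.unitary_cocycle_pow_unitary_cover_exponent
          [OF fin unitary_cocycles_restrict[OF sub that], of x y] xy
      by (simp add: k e_def power_mult)
    ultimately show ?thesis by blast
  qed
  then show ?thesis
    unfolding N_def[symmetric] by (intro unitary_cover_exponent_dvd) auto
qed

end
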